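(* Assume the setting described in the context. For every $v\in\{0,\dots,\tau-1\}$ and every integer $u\ge0$, $$k_{v,u}=\frac{\gamma_{v,u}\cdot\mathbf c_{v,u}}{D_v}=\frac{\sum_{w=0}^{\tau-1}m^{F_{v+u,w}}\,l^{\overline{E}_{v,\tau-1-w}}\,c_{v+w,u}}{l^{\overline{E}_{v,\tau}}-m^{F_{v,\tau}}}.$$
   Context: Setting. Let $m,l\ge 2$ be coprime integers and $\tau\ge1$ an integer. Let $f_0,\dots,f_{\tau-1}$ be positive integers. Let $(a_{v,i})$, $v\in\{0,\dots,\tau-1\}$, $i\in\{0,\dots,l-1\}$, be integers with $a_{v,0}=0$ and, for $i\neq0$: $a_{v,i}\equiv -m^{f_v}i \pmod l$, $a_{v,i}\not\equiv0\pmod m$ and $a_{v,i}\not\equiv 0\pmod l$. For each $v\in\{0,\dots,\tau-1\}$ fix an admissible choice: an index $i_v\in\{1,\dots,l-1\}$, with $a_v:=a_{v,i_v}$; an integer $s_v$ with $1\le s_v\le m^{f_v}-1$ and $\gcd(s_v,m)=1$; and positive integers $e_v,r_v$ with $r_v\equiv i_v\pmod l$, $l^{e_v}s_v=m^{f_v}r_v+a_v$, and $|a_v|<\max(m^{f_v},l^{e_v})$. All indexed quantities are extended $\tau$-periodically to all integer indices. Sums. For $v\in\mathbb Z$, $u\ge0$: $F_{v,u}=\sum_{y=0}^{u-1}f_{v+y}$, $\overline{E}_{v,u}=\sum_{y=0}^{u-1}e_{v-1-y}$. Let $\gamma_{v,u}=\big(m^{F_{v+u,w}}l^{\overline{E}_{v,\tau-1-w}}\big)_{w=0}^{\tau-1}$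 and $D_v=l^{\overline{E}_{v,\tau}}-m^{F_{v,\tau}}$; $\cdot$ is the ordinary dot product. Iterates. Let $\mathbb Z_{\langle m,l\rangle}$ be the subring of $\mathbb Q$ of fractions whose denominators are coprime to both $m$ and $l$. Let $(n_v)_{v\in\mathbb Z}$ be a $\tau$-periodic sequence in $\mathbb Z_{\langle m,l\rangle}$ with $n_v\equiv s_v\pmod{m^{f_v}}$ and $n_{v+1}=l^{e_v}\frac{n_v-s_v}{m^{f_v}}+r_v$ for all $v$. Graded digits. $k_{v,0}=n_v$, $k_{v,u}=m^{f_{v+u}}k_{v,u+1}+d_{v,u}$ with $d_{v,u}\in\{0,\dots,m^{f_{v+u}}-1\}$, $k_{v,u+1}\in\mathbb Z_{\langle m,l\rangle}$; $j_{v,0}=n_v$, $j_{v,u}=l^{e_{v-1-u}}j_{v,u+1}+b_{v,u}$ with $b_{v,u}\in\{0,\dots,l^{e_{v-1-u}}-1\}$, $j_{v,u+1}\in\mathbb Z_{\langle m,l\rangle}$. First subscripts are taken modulo $\tau$. Digit differences. $c_{v,0}=a_v$ and $c_{v,u}=d_{v+1,u-1}-b_{v+u,u-1}$ for $u\ge1$; $\mathbf c_{v,u}=(c_{v+w,u})_{w=0}^{\tau-1}$. *)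

theory Defs
  imports
    Complex_Main
    "HOL-Number_Theory.Cong"
    "HOL-Library.Periodic_Fun"
    "Jordan_Normal_Form.Matrix"
begin

definition Z_loc :: "int \<Rightarrow> int \<Rightarrow> rat set" where
  "Z_loc m l = {of_int p / of_int q | p q. q \<noteq> 0 \<and> coprime q m \<and> coprime q l}"

(* Congruence modulo the principal ideal generated by the integer N in the ring Z_loc m l. *)
definition cong_loc :: "int \<Rightarrow> int \<Rightarrow> int \<Rightarrow> rat \<Rightarrow> rat \<Rightarrow> bool" where
  "cong_loc m l N x y \<longleftrightarrow> (\<exists>z\<in>Z_loc m l. x - y = of_int N * z)"

definition Fsum :: "(int \<Rightarrow> nat) \<Rightarrow> int \<Rightarrow> nat \<Rightarrow> nat" where
  "Fsum f v u = (\<Sum>y<u. f (v + int y))"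

definition Ebar :: "(int \<Rightarrow> nat) \<Rightarrow> int \<Rightarrow> nat \<Rightarrow> nat" where
  "Ebar e v u = (\<Sum>y<u. e (v - 1 - int y))"

definition gamma_vec ::
    "int \<Rightarrow> int \<Rightarrow> nat \<Rightarrow> (int \<Rightarrow> nat) \<Rightarrow> (int \<Rightarrow> nat) \<Rightarrow> int \<Rightarrow> nat \<Rightarrow> int vec" where
  "gamma_vec m l \<tau> f e v u =
     vec \<tau> (\<lambda>w. m ^ Fsum f (v + int u) w * l ^ Ebar e v (\<tau> - 1 - w))"

definition Dden :: "int \<Rightarrow> int \<Rightarrow> nat \<Rightarrow> (int \<Rightarrow> nat) \<Rightarrow> (int \<Rightarrow> nat) \<Rightarrow> int \<Rightarrow> int" where
  "Dden m l \<tau> f e v = l ^ Ebar e v \<tau> - m ^ Fsum f v \<tau>"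

(* The argument a is the sequence of the chosen values a_v = a_{v,i_v};
   d and b are the graded digits to the bases m and l. *)
fun digit_diff ::
    "(int \<Rightarrow> int) \<Rightarrow> (int \<Rightarrow> nat \<Rightarrow> int) \<Rightarrow> (int \<Rightarrow> nat \<Rightarrow> int) \<Rightarrow> int \<Rightarrow> nat \<Rightarrow> int" where
  "digit_diff a d b v 0 = a v"
| "digit_diff a d b v (Suc u) = d (v + 1) u - b (v + int (Suc u)) u"

definition digit_diff_vec ::
    "nat \<Rightarrow> (int \<Rightarrow> int) \<Rightarrow> (int \<Rightarrow> nat \<Rightarrow> int) \<Rightarrow> (int \<Rightarrow> nat \<Rightarrow> int) \<Rightarrow> int \<Rightarrow> nat \<Rightarrow> int vec" where
  "digit_diff_vec \<tau> a d b v u = vec \<tau> (\<lambda>w. digit_diff a d b (v + int w) u)"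

end

theory Submission
  imports Defs
begin

text \<open>
  The two digit expansions share their remainders: \<open>k\<^bsub>v,u\<^esub> = j\<^bsub>v+u,u\<^esub>\<close>, by induction on \<open>u\<close>.
  Granting this at level \<open>u\<close>, the difference \<open>k\<^bsub>v,u+1\<^esub> - j\<^bsub>v+u+1,u+1\<^esub>\<close>
  becomes an integer after multiplication by \<open>M = m\<^bsup>f\<^esup> l\<^bsup>e\<^esup>\<close>, the digit bounds make
  that integer smaller than \<open>M\<close> in absolute value, and an integer in \<open>M\<close> times the localised ring
  is divisible by \<open>M\<close>; hence it vanishes. The base case uses that \<open>s\<^sub>v\<close> and \<open>r\<^sub>v\<close> are themselves
  the lowest digits of \<open>n\<^sub>v\<close> and \<open>n\<^bsub>v+1\<^esub>\<close>.
  It follows that \<open>l\<^bsup>e\<^esup> k\<^bsub>v,u\<^esub> = m\<^bsup>f\<^esup> k\<^bsub>v+1,u\<^esub> + c\<^bsub>v,u\<^esub>\<close>, and iterating this affine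
  recurrence over one period gives a linear equation for \<open>k\<^bsub>v,u\<^esub>\<close> with leading coefficient \<open>D\<^sub>v\<close>.
\<close>

section \<open>Periodicity and arithmetic in the localised ring\<close>

lemma periodic_fun_simple_mod:
  fixes g :: "int \<Rightarrow> 'b"
  assumes "periodic_fun_simple g p"
  shows "g (v mod p) = g v"
proof -
  interpret periodic_fun_simple g p by fact
  have "g (v mod p + of_int (v div p) * p) = g (v mod p)"
    by (rule plus_of_int)
  then show ?thesis by simp
qed

lemma Z_loc_diff:
  assumes "x \<in> Z_loc m l" "y \<in> Z_loc m l"
  shows "x - y \<in> Z_loc m l"
proof -
  obtain p q where x: "x = of_int p / of_int q" "q \<noteq> 0" "coprime q m" "coprime q l"
    using assms(1) unfolding Z_loc_def by blast
  obtain p' q' where y: "y = of_int p' / of_int q'" "q' \<noteq> 0" "coprime q' m" "coprime q' l"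
    using assms(2) unfolding Z_loc_def by blast
  have "x - y = of_int (p * q' - p' * q) / of_int (q * q')"
    using x y by (simp add: diff_frac_eq)
  moreover have "q * q' \<noteq> 0" "coprime (q * q') m" "coprime (q * q') l"
    using x y by simp_all
  ultimately show ?thesis unfolding Z_loc_def by blast
qed

text \<open>Clearing the denominator \<open>q\<close> of \<open>z\<close> gives
  \<open>m ^ i * l ^ h dvd M * q\<close>, and \<open>q\<close> cancels because it is coprime to both
  bases.\<close>

lemma Z_loc_dvd:
  assumes "z \<in> Z_loc m l" and "of_int (m ^ i * l ^ h) * z = of_int M"
  shows "m ^ i * l ^ h dvd M"
proof -
  obtain p q where z: "z = of_int p / of_int q" "q \<noteq> 0" "coprime q m" "coprime q l"
    using assms(1) unfolding Z_loc_def by blast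
  have "(of_int (m ^ i * l ^ h * p) :: rat) = of_int (M * q)"
    using assms(2) z by (simp add: field_simps)
  then have "m ^ i * l ^ h * p = M * q" by (simp only: of_int_eq_iff)
  then have "m ^ i * l ^ h dvd M * q" by (metis dvd_triv_left)
  moreover have "coprime (m ^ i * l ^ h) q"
    using z by (simp add: coprime_commute)
  ultimately show ?thesis by (simp add: coprime_dvd_mult_left_iff)
qed

text \<open>The difference \<open>y - x\<close> is a multiple of the modulus and smaller than it,
  hence zero. The mixed modulus covers base \<open>m\<close> (\<open>h = 0\<close>), base
  \<open>l\<close> (\<open>i = 0\<close>) and the product needed when the two expansions are
  compared.\<close>

lemma Z_loc_digit_unique:
  assumes "z \<in> Z_loc m l" "z' \<in> Z_loc m l"
    and eq: "of_int (m ^ i * l ^ h) * z + of_int x = of_int (m ^ i * l ^ h) * z' + of_int y"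
    and bound: "\<bar>x - y\<bar> < m ^ i * l ^ h"
  shows "x = y" "z = z'"
proof -
  have "of_int (m ^ i * l ^ h) * (z - z') = of_int (y - x)"
    using eq by (simp add: algebra_simps)
  then have "m ^ i * l ^ h dvd y - x"
    using Z_loc_dvd Z_loc_diff[OF assms(1,2)] by blast
  then show xy: "x = y"
    using dvd_imp_le_int[of "y - x"] bound by fastforce
  have "m ^ i * l ^ h \<noteq> 0" using bound by linarith
  then have "(of_int (m ^ i * l ^ h) :: rat) \<noteq> 0" by (simp only: of_int_eq_0_iff not_False_eq_True)
  with eq xy show "z = z'" by (metis add_right_cancel mult_left_cancel)
qed

section \<open>Exponent sums and affine recurrences\<close>

lemma Fsum_Suc: "Fsum f v (Suc t) = Fsum f v t + f (v + int t)"
  by (simp add: Fsum_def)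

lemma Ebar_Suc: "Ebar e (v + 1) (Suc t) = e v + Ebar e v t"
  unfolding Ebar_def by (subst sum.lessThan_Suc_shift) (simp add: algebra_simps)

lemma Fsum_shift:
  assumes "periodic_fun_simple f (int \<tau>)"
  shows "Fsum f (v + int u) \<tau> = Fsum f v \<tau>"
proof (induction u)
  case (Suc u)
  interpret periodic_fun_simple f "int \<tau>" by fact
  have "Fsum f x (Suc \<tau>) = f x + Fsum f (x + 1) \<tau>" for x
    unfolding Fsum_def by (subst sum.lessThan_Suc_shift) (simp add: algebra_simps)
  then have "Fsum f x \<tau> + f (x + int \<tau>) = f x + Fsum f (x + 1) \<tau>" for x
    by (simp add: Fsum_Suc)
  then have "Fsum f (x + 1) \<tau> = Fsum f x \<tau>" for x
    by (metis add.commute add_left_cancel plus_period)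
  from this[of "v + int u"] show ?case using Suc by (simp add: algebra_simps)
qed simp

lemma Ebar_periodic:
  assumes "periodic_fun_simple e (int \<tau>)"
  shows "Ebar e (v + int \<tau>) t = Ebar e v t"
proof -
  interpret periodic_fun_simple e "int \<tau>" by fact
  have "e (v + int \<tau> - 1 - int y) = e (v - 1 - int y)" for y
    using plus_period[of "v - 1 - int y"] by (simp add: algebra_simps)
  then show ?thesis by (simp add: Ebar_def)
qed

text \<open>Each step multiplies the previous identity by \<open>L ^ e (v + int t)\<close> and
  applies the recurrence at \<open>v + int t\<close>. Since \<open>Ebar\<close> looks backwards, its
  base point has to move along with \<open>t\<close>; the offset \<open>o'\<close> allows for the
  level \<open>u\<close> in the exponents of \<open>m\<close>.\<close>

lemma affine_recurrence_iterate:
  fixes x :: "int \<Rightarrow> 'a::comm_ring_1" and M L :: 'a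
  assumes "\<And>v. L ^ e v * x v = M ^ f (v + o') * x (v + 1) + c v"
  shows "L ^ Ebar e (v + int t) t * x v =
    M ^ Fsum f (v + o') t * x (v + int t) +
    (\<Sum>w<t. M ^ Fsum f (v + o') w * L ^ Ebar e (v + int t) (t - 1 - w) * c (v + int w))"
proof (induction t)
  case 0
  show ?case by (simp add: Ebar_def Fsum_def)
next
  case (Suc t)
  let ?v = "v + int t"
  have E: "Ebar e (v + int (Suc t)) (Suc y) = e ?v + Ebar e ?v y" for y
    using Ebar_Suc[of e ?v y] by (simp add: algebra_simps)
  \<comment> \<open>For \<open>w < t\<close> the subtraction does not truncate. The new summand
    \<open>w = t\<close> carries the empty sum \<open>Ebar _ _ 0\<close> and is treated
    separately.\<close>
  have E': "Ebar e (v + int (Suc t)) (Suc t - 1 - w) = e ?v + Ebar e ?v (t - 1 - w)"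
    if "w < t" for w
  proof -
    have "Suc t - 1 - w = Suc (t - 1 - w)" using that by simp
    then show ?thesis by (simp only: E)
  qed
  let ?S = "\<Sum>w<t. M ^ Fsum f (v + o') w * L ^ Ebar e ?v (t - 1 - w) * c (v + int w)"
  have S: "(\<Sum>w<t. M ^ Fsum f (v + o') w * L ^ Ebar e (v + int (Suc t)) (Suc t - 1 - w)
             * c (v + int w)) = L ^ e ?v * ?S"
    unfolding sum_distrib_left
  proof (rule sum.cong)
    fix w assume "w \<in> {..<t}"
    then have "w < t" by simp
    then show "M ^ Fsum f (v + o') w * L ^ Ebar e (v + int (Suc t)) (Suc t - 1 - w) * c (v + int w) =
        L ^ e ?v * (M ^ Fsum f (v + o') w * L ^ Ebar e ?v (t - 1 - w) * c (v + int w))"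
      by (simp only: E' power_add mult.assoc mult.left_commute)
  qed simp
  have "L ^ Ebar e (v + int (Suc t)) (Suc t) * x v = L ^ e ?v * (L ^ Ebar e ?v t * x v)"
    unfolding E by (simp add: power_add algebra_simps)
  also have "\<dots> = M ^ Fsum f (v + o') t * (L ^ e ?v * x ?v) + L ^ e ?v * ?S"
    unfolding Suc by (simp add: algebra_simps)
  also have "L ^ e ?v * x ?v = M ^ f (?v + o') * x (?v + 1) + c ?v" by (rule assms)
  also have "M ^ Fsum f (v + o') t * \<dots> + L ^ e ?v * ?S =
      M ^ Fsum f (v + o') (Suc t) * x (v + int (Suc t)) +
      (L ^ e ?v * ?S + M ^ Fsum f (v + o') t * c ?v)"
    by (simp add: Fsum_Suc power_add algebra_simps)
  finally show ?case
    unfolding sum.lessThan_Suc S by (simp add: Ebar_def)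
qed

text \<open>After a full period the iterate returns to \<open>x v\<close>, so the two occurrences of
  \<open>x\<close> can be collected on one side.\<close>

lemma affine_recurrence_periodic:
  fixes x :: "int \<Rightarrow> 'a::comm_ring_1" and M L :: 'a
  assumes "\<And>v. L ^ e v * x v = M ^ f (v + int u) * x (v + 1) + c v"
    and "periodic_fun_simple x (int \<tau>)" "periodic_fun_simple e (int \<tau>)"
      "periodic_fun_simple f (int \<tau>)"
  shows "(L ^ Ebar e v \<tau> - M ^ Fsum f v \<tau>) * x v =
    (\<Sum>w<\<tau>. M ^ Fsum f (v + int u) w * L ^ Ebar e v (\<tau> - 1 - w) * c (v + int w))"
proof -
  interpret x: periodic_fun_simple x "int \<tau>" by fact
  show ?thesis
    using affine_recurrence_iterate[where L = L and e = e and x = x and M = M and f = f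
        and o' = "int u" and c = c and t = \<tau> and v = v, OF assms(1)]
    by (simp add: Ebar_periodic[OF assms(3)] Fsum_shift[OF assms(4)] x.plus_period algebra_simps)
qed

section \<open>Nonvanishing denominator and size of \<open>r\<close>\<close>

text \<open>Equal powers of the coprime bases would be units, but the exponent of \<open>l\<close>
  is positive.\<close>

lemma Dden_nonzero:
  assumes "l \<ge> 2" "coprime m l" "\<tau> \<ge> 1" "\<And>v. e v > 0"
  shows "Dden m l \<tau> f e v \<noteq> 0"
proof
  assume "Dden m l \<tau> f e v = 0"
  then have "l ^ Ebar e v \<tau> = m ^ Fsum f v \<tau>" by (simp add: Dden_def)
  moreover have "coprime (m ^ Fsum f v \<tau>) (l ^ Ebar e v \<tau>)" using assms(2) by simp
  ultimately have "is_unit (l ^ Ebar e v \<tau>)" by simp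
  moreover have "Ebar e v \<tau> > 0"
    unfolding Ebar_def using assms(3,4) by (intro sum_pos) (auto simp: lessThan_empty_iff)
  ultimately show False using assms(1) one_less_power[of l "Ebar e v \<tau>"] by simp
qed

text \<open>This makes \<open>r\<close> a legitimate digit to the base \<open>l ^ e\<close>. The
  bounds on \<open>s\<close> and \<open>a\<close> alone yield only \<open>r \<le> l ^ e\<close>;
  equality would force \<open>l dvd i\<close>.\<close>

lemma admissible_r_less:
  fixes m l s r i a :: int
  assumes "m \<ge> 2" "l \<ge> 2" "e > 0" "s \<le> m ^ f - 1" "[r = i] (mod l)" "i \<in> {1..l - 1}"
    and eq: "l ^ e * s = m ^ f * r + a" and a: "\<bar>a\<bar> < max (m ^ f) (l ^ e)"
  shows "r < l ^ e"
proof -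
  have pos: "m ^ f > 0" "l ^ e > 0" using assms(1,2) by simp_all
  have "l ^ e * s \<le> l ^ e * (m ^ f - 1)" using assms(4) pos by (intro mult_left_mono) auto
  then have "m ^ f * r < m ^ f * (l ^ e + 1)"
    using eq a pos by (simp add: algebra_simps max_def split: if_splits)
  then have "r \<le> l ^ e" using pos by (simp add: mult_less_cancel_left_pos)
  moreover have "r \<noteq> l ^ e"
  proof
    assume "r = l ^ e"
    then have "l dvd r" using assms(3) by simp
    then have "l dvd i" using assms(5) by (simp add: cong_dvd_iff)
    then show False using assms(6) zdvd_not_zless[of i l] by auto
  qed
  ultimately show ?thesis by simp
qed

section \<open>Shared remainders and the closed formula\<close>

theorem theorem4p6:
  fixes m l :: int and \<tau> :: nat
    and f e :: "int \<Rightarrow> nat"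
    and a :: "int \<Rightarrow> int \<Rightarrow> int"
    and ix s r :: "int \<Rightarrow> int"
    and n :: "int \<Rightarrow> rat"
    and k j :: "int \<Rightarrow> nat \<Rightarrow> rat"
    and d b :: "int \<Rightarrow> nat \<Rightarrow> int"
  assumes "m \<ge> 2" and "l \<ge> 2" and "coprime m l" and "\<tau> \<ge> 1"
    and f_periodic: "periodic_fun_simple f (int \<tau>)"
    and a_periodic: "\<forall>i\<in>{0..<l}. periodic_fun_simple (\<lambda>v. a v i) (int \<tau>)"
    and ix_periodic: "periodic_fun_simple ix (int \<tau>)"
    and s_periodic: "periodic_fun_simple s (int \<tau>)"
    and e_periodic: "periodic_fun_simple e (int \<tau>)"
    and r_periodic: "periodic_fun_simple r (int \<tau>)"
    and f_pos: "\<forall>v\<in>{0..<int \<tau>}. f v > 0"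
    and a_zero: "\<forall>v\<in>{0..<int \<tau>}. a v 0 = 0"
    and a_nonzero: "\<forall>v\<in>{0..<int \<tau>}. \<forall>i\<in>{0..<l}. i \<noteq> 0 \<longrightarrow>
          [a v i = - (m ^ f v) * i] (mod l) \<and> \<not> [a v i = 0] (mod m) \<and> \<not> [a v i = 0] (mod l)"
    and ix_range: "\<forall>v\<in>{0..<int \<tau>}. ix v \<in> {1..l - 1}"
    and s_range: "\<forall>v\<in>{0..<int \<tau>}. 1 \<le> s v \<and> s v \<le> m ^ f v - 1 \<and> gcd (s v) m = 1"
    and er_pos: "\<forall>v\<in>{0..<int \<tau>}. e v > 0 \<and> r v > 0"
    and r_cong: "\<forall>v\<in>{0..<int \<tau>}. [r v = ix v] (mod l)"
    and admissible_eq: "\<forall>v\<in>{0..<int \<tau>}. l ^ e v * s v = m ^ f v * r v + a v (ix v)"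
    and admissible_bound: "\<forall>v\<in>{0..<int \<tau>}. \<bar>a v (ix v)\<bar> < max (m ^ f v) (l ^ e v)"
    and n_periodic: "periodic_fun_simple n (int \<tau>)"
    and n_in: "\<forall>v. n v \<in> Z_loc m l"
    and n_cong: "\<forall>v. cong_loc m l (m ^ f v) (n v) (of_int (s v))"
    and n_step: "\<forall>v. n (v + 1) =
          of_int (l ^ e v) * ((n v - of_int (s v)) / of_int (m ^ f v)) + of_int (r v)"
    and kj_periodic: "periodic_fun_simple k (int \<tau>)" "periodic_fun_simple j (int \<tau>)"
    and db_periodic: "periodic_fun_simple d (int \<tau>)" "periodic_fun_simple b (int \<tau>)"
    and k_zero: "\<forall>v. k v 0 = n v"
    and k_step: "\<forall>v u. k v u = of_int (m ^ f (v + int u)) * k v (Suc u) + of_int (d v u)"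
    and k_in: "\<forall>v u. k v (Suc u) \<in> Z_loc m l"
    and d_range: "\<forall>v u. d v u \<in> {0..m ^ f (v + int u) - 1}"
    and j_zero: "\<forall>v. j v 0 = n v"
    and j_step: "\<forall>v u. j v u = of_int (l ^ e (v - 1 - int u)) * j v (Suc u) + of_int (b v u)"
    and j_in: "\<forall>v u. j v (Suc u) \<in> Z_loc m l"
    and b_range: "\<forall>v u. b v u \<in> {0..l ^ e (v - 1 - int u) - 1}"
  shows "\<forall>v\<in>{0..<int \<tau>}. \<forall>u.
      k v u = of_int (gamma_vec m l \<tau> f e v u \<bullet> digit_diff_vec \<tau> (\<lambda>v. a v (ix v)) d b v u)
                / of_int (Dden m l \<tau> f e v)
    \<and> of_int (gamma_vec m l \<tau> f e v u \<bullet> digit_diff_vec \<tau> (\<lambda>v. a v (ix v)) d b v u)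
                / of_int (Dden m l \<tau> f e v)
      = (\<Sum>w = 0..\<tau> - 1. of_int (m ^ Fsum f (v + int u) w * l ^ Ebar e v (\<tau> - 1 - w)
                * digit_diff (\<lambda>v. a v (ix v)) d b (v + int w) u))
        / (of_int (l ^ Ebar e v \<tau> - m ^ Fsum f v \<tau>) :: rat)"
proof -
  let ?A = "\<lambda>v. a v (ix v)"
  let ?c = "digit_diff ?A d b"
  note per = f_periodic s_periodic e_periodic r_periodic ix_periodic
  note md = per[THEN periodic_fun_simple_mod]
  \<comment> \<open>The setting constrains one period only; reduction modulo \<open>\<tau>\<close>
    carries each condition to all integers \<open>v\<close>.\<close>
  have res: "v mod int \<tau> \<in> {0..<int \<tau>}" for v using \<open>\<tau> \<ge> 1\<close> by simp
  have ix: "ix v \<in> {1..l - 1}" for v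
    using bspec[OF ix_range res[of v]] md by simp
  have A_mod: "a (v mod int \<tau>) (ix v) = ?A v" for v
    using periodic_fun_simple_mod[OF bspec[OF a_periodic], of "ix v" v] ix[of v] by simp
  have e_pos: "e v > 0" "r v > 0" for v
    using bspec[OF er_pos res[of v]] md by simp_all
  have s_bd: "1 \<le> s v" "s v \<le> m ^ f v - 1" for v
    using bspec[OF s_range res[of v]] md by simp_all
  have adm: "l ^ e v * s v = m ^ f v * r v + ?A v" for v
    using bspec[OF admissible_eq res[of v]] by (simp add: md A_mod)
  have r_less: "r v < l ^ e v" for v
  proof (rule admissible_r_less[OF \<open>m \<ge> 2\<close> \<open>l \<ge> 2\<close> e_pos(1) s_bd(2) _ ix adm])
    show "[r v = ix v] (mod l)" using bspec[OF r_cong res[of v]] md by simp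
    show "\<bar>?A v\<bar> < max (m ^ f v) (l ^ e v)"
      using bspec[OF admissible_bound res[of v]] by (simp add: md A_mod)
  qed
  have pos: "m ^ i > 0" "l ^ i > 0" for i using \<open>m \<ge> 2\<close> \<open>l \<ge> 2\<close> by simp_all
  have d_bd: "0 \<le> d v u" "d v u < m ^ f (v + int u)" for v u
    using d_range[rule_format, of v u] by simp_all
  have b_bd: "0 \<le> b (v + int (Suc u)) u" "b (v + int (Suc u)) u < l ^ e v" for v u
    using b_range[rule_format, of "v + int (Suc u)" u] by simp_all
  have j_step': "j (v + int (Suc u)) u =
      of_int (l ^ e v) * j (v + int (Suc u)) (Suc u) + of_int (b (v + int (Suc u)) u)" for v u
    using j_step[rule_format, of "v + int (Suc u)" u] by simp
  \<comment> \<open>Clearing the denominator in \<open>n_step\<close> leaves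
    \<open>m ^ f v * r v - l ^ e v * s v\<close>, which is \<open>- ?A v\<close> by
    admissibility.\<close>
  have k_step0: "of_int (l ^ e v) * k v 0 = of_int (m ^ f v) * k (v + 1) 0 + of_int (?A v)" for v
  proof -
    have "of_int (m ^ f v) * n (v + 1) =
        of_int (l ^ e v) * n v - of_int (l ^ e v * s v) + of_int (m ^ f v * r v)"
      using n_step[rule_format, of v] pos(1)[of "f v"] \<open>m \<ge> 2\<close> by (simp add: field_simps)
    then show ?thesis unfolding adm k_zero[rule_format] by simp
  qed
  \<comment> \<open>Shared remainders are assumed only up to level \<open>u\<close>, so that the
    recurrence is available inside the induction proving them. For \<open>u = Suc t\<close> the
    number \<open>k (v + 1) t = j (v + int u) t\<close> is expanded in both bases; the two lowest
    digits differ by \<open>?c v u\<close>.\<close>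
  have rec_aux: "of_int (l ^ e v) * k v u = of_int (m ^ f (v + int u)) * k (v + 1) u + of_int (?c v u)"
    if kj: "\<And>u' v. u' \<le> u \<Longrightarrow> k v u' = j (v + int u') u'" for u v
  proof (cases u)
    case 0
    then show ?thesis using k_step0 by simp
  next
    case (Suc t)
    have "of_int (l ^ e v) * k v u + of_int (b (v + int u) t) = k (v + 1) t"
      using kj[of u v] kj[of t "v + 1"] j_step'[of v t] by (simp add: Suc algebra_simps)
    also have "\<dots> = of_int (m ^ f (v + int u)) * k (v + 1) u + of_int (d (v + 1) t)"
      using k_step[rule_format, of "v + 1" t] by (simp add: Suc algebra_simps)
    finally show ?thesis by (simp add: Suc algebra_simps)
  qed
  have kj: "k v u = j (v + int u) u" for u v
  proof (induction u arbitrary: v rule: less_induct)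
    case (less u v)
    show ?case
    proof (cases u)
      case 0
      then show ?thesis using k_zero j_zero by simp
    next
      case (Suc t)
      let ?M = "m ^ f (v + int t)" and ?L = "l ^ e v"
      let ?b = "b (v + int (Suc t)) t" and ?d = "d v t"
      have IH: "k v u' = j (v + int u') u'" if "u' \<le> t" for u' v
        using less.IH that Suc by simp
      have "k v (Suc t) = j (v + int (Suc t)) (Suc t)"
      \<comment> \<open>At level 0 the value \<open>?c v 0\<close> is \<open>?A v\<close> rather
        than a difference of digits, so the later estimate does not apply. Instead uniqueness of
        digits is used first in base \<open>m\<close>, for \<open>s v\<close>, and then in base
        \<open>l\<close>, for \<open>r v\<close>.\<close>
      proof (cases t)
        case 0
        obtain z where z: "z \<in> Z_loc m l" "n v - of_int (s v) = of_int (m ^ f v) * z"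
          using n_cong unfolding cong_loc_def by blast
        have "z = k v 1"
        proof (rule Z_loc_digit_unique(2))
          show "z \<in> Z_loc m l" "k v 1 \<in> Z_loc m l" using z k_in[rule_format, of v 0] by simp_all
          show "of_int (m ^ f v * l ^ 0) * z + of_int (s v) =
              of_int (m ^ f v * l ^ 0) * k v 1 + of_int (d v 0)"
            using z(2) k_step[rule_format, of v 0] k_zero by (simp add: algebra_simps)
          show "\<bar>s v - d v 0\<bar> < m ^ f v * l ^ 0"
            using s_bd[of v] d_bd[of v 0] by simp
        qed
        then have n1: "n (v + 1) = of_int (l ^ e v) * k v 1 + of_int (r v)"
          using z(2) n_step[rule_format, of v] \<open>m \<ge> 2\<close> by simp
        have "k v 1 = j (v + 1) 1"
        proof (rule Z_loc_digit_unique(2))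
          show "k v 1 \<in> Z_loc m l" "j (v + 1) 1 \<in> Z_loc m l"
            using k_in[rule_format, of v 0] j_in[rule_format, of "v + 1" 0] by simp_all
          show "of_int (m ^ 0 * l ^ e v) * k v 1 + of_int (r v) =
              of_int (m ^ 0 * l ^ e v) * j (v + 1) 1 + of_int (b (v + 1) 0)"
            using n1 j_step'[of v 0] j_zero by simp
          show "\<bar>r v - b (v + 1) 0\<bar> < m ^ 0 * l ^ e v"
            using e_pos(2)[of v] r_less[of v] b_bd[of v 0] by simp
        qed
        with 0 show ?thesis by simp
      next
        case t: (Suc t')
        show ?thesis
        proof (rule Z_loc_digit_unique(2))
          show "k v (Suc t) \<in> Z_loc m l" "j (v + int (Suc t)) (Suc t) \<in> Z_loc m l"
            using k_in j_in by blast+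
          have "k (v + 1) t = of_int ?L * j (v + int (Suc t)) (Suc t) + of_int ?b"
            using IH[of t "v + 1"] j_step'[of v t] by (simp add: algebra_simps)
          with rec_aux[of t v, OF IH] k_step[rule_format, of v t]
          have "of_int ?L * (of_int ?M * k v (Suc t) + of_int ?d) =
              of_int ?M * (of_int ?L * j (v + int (Suc t)) (Suc t) + of_int ?b) + of_int (?c v t)"
            by (simp only:)
          then show "of_int (?M * ?L) * k v (Suc t) + of_int (?L * ?d) =
              of_int (?M * ?L) * j (v + int (Suc t)) (Suc t) + of_int (?M * ?b + ?c v t)"
            by (simp add: algebra_simps)
          \<comment> \<open>The digit bounds leave slack \<open>?L\<close> above and
            \<open>?M\<close> below, which is just enough to absorb \<open>?c v t\<close>, strictly
            between \<open>- ?L\<close> and \<open>?M\<close>.\<close>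
          have "?L * ?d \<le> ?L * (?M - 1)" "?M * ?b \<le> ?M * (?L - 1)" "0 \<le> ?L * ?d" "0 \<le> ?M * ?b"
            using d_bd[of v t] b_bd[of v t] pos
            by (auto intro!: mult_left_mono simp: less_imp_le simp del: of_nat_Suc)
          moreover have "- ?L < ?c v t" "?c v t < ?M"
            using d_bd[of "v + 1" t'] b_bd[of v t'] by (simp_all add: t algebra_simps)
          ultimately show "\<bar>?L * ?d - (?M * ?b + ?c v t)\<bar> < ?M * ?L"
            by (simp add: algebra_simps abs_less_iff)
        qed
      qed
      with Suc show ?thesis by simp
    qed
  qed
  have rec: "of_int l ^ e v * k v u =
      of_int m ^ f (v + int u) * k (v + 1) u + of_int (?c v u)" for v u
    using rec_aux[OF kj] by simp
  have k_per: "periodic_fun_simple (\<lambda>v. k v u) (int \<tau>)" for u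
    using kj_periodic(1) by (simp add: periodic_fun_simple_def)
  show ?thesis
  proof (intro ballI allI)
    fix v u
    let ?S = "\<Sum>w<\<tau>. m ^ Fsum f (v + int u) w * l ^ Ebar e v (\<tau> - 1 - w) * ?c (v + int w) u"
    have dot: "gamma_vec m l \<tau> f e v u \<bullet> digit_diff_vec \<tau> ?A d b v u = ?S"
      by (simp add: scalar_prod_def gamma_vec_def digit_diff_vec_def atLeast0LessThan)
    have "of_int (Dden m l \<tau> f e v) * k v u = of_int ?S"
      using affine_recurrence_periodic[where x = "\<lambda>v. k v u" and c = "\<lambda>v. of_int (?c v u)",
          OF rec k_per e_periodic f_periodic, of v]
      by (simp add: Dden_def)
    moreover have "Dden m l \<tau> f e v \<noteq> 0"
      using Dden_nonzero \<open>l \<ge> 2\<close> \<open>coprime m l\<close> \<open>\<tau> \<ge> 1\<close> e_pos(1) by blast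
    ultimately have "k v u = of_int ?S / of_int (Dden m l \<tau> f e v)"
      by (simp add: eq_divide_eq mult.commute)
    moreover have "{0..\<tau> - 1} = {..<\<tau>}" using \<open>\<tau> \<ge> 1\<close> by auto
    ultimately show "k v u = of_int (gamma_vec m l \<tau> f e v u \<bullet> digit_diff_vec \<tau> ?A d b v u)
                / of_int (Dden m l \<tau> f e v)
    \<and> of_int (gamma_vec m l \<tau> f e v u \<bullet> digit_diff_vec \<tau> ?A d b v u)
                / of_int (Dden m l \<tau> f e v)
      = (\<Sum>w = 0..\<tau> - 1. of_int (m ^ Fsum f (v + int u) w * l ^ Ebar e v (\<tau> - 1 - w)
                * ?c (v + int w) u))
        / (of_int (l ^ Ebar e v \<tau> - m ^ Fsum f v \<tau>) :: rat)"
      unfolding dot Dden_def by (simp only: of_int_sum)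
  qed
qed

end
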